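(* Let $g:\mathbb{R}\to\mathbb{R}$ be a (finite) convex function with $g(0)=0$, let $a\in\mathbb{R}^n$ with $a_i\ne0$ for all $i\in[n]$, let $\mathcal{I}_+\subseteq[n]$, and let $$\mathcal{Q}_1=\Big\{(t,x,z)\in\mathbb{R}^{n+1}\times\{0,1\}^n:\ t\ge g\Big(\sum_{i=1}^n a_ix_i\Big),\ x_i\ge0\ \forall i\in\mathcal{I}_+,\ x_i(1-z_i)=0\ \forall i\in[n]\Big\}.$$ Then $(t,x,z)\in\operatorname{cl\,conv}(\mathcal{Q}_1)$ if and only if there exist $\lambda,\tau\in\mathbb{R}^n$ such that $$t\ge\sum_{i=1}^n g^\pi(a_i(x_i-\tau_i),\lambda_i),\qquad a^\top\tau=0,\qquad 0\le\tau_i\le x_i\ \ \forall i\in\mathcal{I}_+,$$ $$\lambda_i\le z_i\le1\ \ \forall i\in[n],\qquad \lambda\ge0,\qquad \sum_{i=1}^n\lambda_i\le1.$$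
   Context: $[n]=\{1,\dots,n\}$; $\operatorname{cl\,conv}(S)$ is the closure of the convex hull of $S$. The perspective function of $g$ is $g^\pi(v,\lambda)=\lambda g(v/\lambda)$ for $\lambda>0$, $g^\pi(v,0)$ is the recession function of $g$ at $v$, i.e. $g^\pi(v,0)=\lim_{\lambda\downarrow0}\lambda g(v/\lambda)\in\mathbb{R}\cup\{+\infty\}$ (here $g(0)=0$), and $g^\pi(v,\lambda)=+\infty$ for $\lambda<0$. *)

theory Defs
  imports "HOL-Analysis.Analysis"
begin

text \<open>The limit at \<open>0\<close> is taken in the extended reals. The definition presupposes
  \<open>g\<close> convex with \<open>g 0 = 0\<close>; the lemma below shows that the limit then exists and is
  never \<open>-\<infinity>\<close>, so finite sums of values of \<open>perspective g\<close> are unproblematic.\<close>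

definition perspective :: "(real \<Rightarrow> real) \<Rightarrow> real \<Rightarrow> real \<Rightarrow> ereal" where
  "perspective g v l =
     (if l > 0 then ereal (l * g (v / l))
      else if l = 0 then Lim (at_right 0) (\<lambda>\<mu>. ereal (\<mu> * g (v / \<mu>)))
      else \<infinity>)"

lemma perspective_0_limit:
  fixes g :: "real \<Rightarrow> real"
  assumes "convex_on UNIV g" and "g 0 = 0"
  shows "((\<lambda>\<mu>. ereal (\<mu> * g (v / \<mu>))) \<longlongrightarrow> perspective g v 0) (at_right 0)"
    and "perspective g v 0 > - \<infinity>"
proof -
  define h where "h = (\<lambda>\<mu>. \<mu> * g (v / \<mu>))"
  have anti: "h \<nu> \<le> h \<mu>" if "0 < \<mu>" "\<mu> \<le> \<nu>" for \<mu> \<nu>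
  proof -
    have "g ((1 - \<mu> / \<nu>) *\<^sub>R 0 + (\<mu> / \<nu>) *\<^sub>R (v / \<mu>)) \<le> (1 - \<mu> / \<nu>) * g 0 + (\<mu> / \<nu>) * g (v / \<mu>)"
      using that by (intro convex_onD[OF assms(1)]) auto
    then have "g (v / \<nu>) \<le> (\<mu> / \<nu>) * g (v / \<mu>)"
      using that assms(2) by simp
    then have "\<nu> * g (v / \<nu>) \<le> \<nu> * ((\<mu> / \<nu>) * g (v / \<mu>))"
      using that by (intro mult_left_mono) auto
    then show ?thesis
      using that by (simp add: h_def)
  qed
  define L where "L = (SUP \<mu>\<in>{0<..}. ereal (h \<mu>))"
  have upper: "ereal (h \<mu>) \<le> L" if "\<mu> > 0" for \<mu>
    unfolding L_def using that by (intro SUP_upper) auto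
  have lim: "((\<lambda>\<mu>. ereal (h \<mu>)) \<longlongrightarrow> L) (at_right 0)"
  proof (rule order_tendstoI)
    fix c assume "c < L"
    then obtain \<nu> where \<nu>: "\<nu> > 0" "c < ereal (h \<nu>)"
      unfolding L_def less_SUP_iff by auto
    have "c < ereal (h \<mu>)" if "0 < \<mu>" "\<mu> < \<nu>" for \<mu>
      using \<nu>(2) anti[of \<mu> \<nu>] that by (meson ereal_less_eq(3) less_imp_le less_le_trans)
    then show "eventually (\<lambda>\<mu>. c < ereal (h \<mu>)) (at_right 0)"
      unfolding eventually_at_right_field using \<nu>(1) by blast
  next
    fix c assume "L < c"
    then have "ereal (h \<mu>) < c" if "0 < \<mu>" for \<mu>
      using upper[OF that] by (rule le_less_trans[rotated])
    then show "eventually (\<lambda>\<mu>. ereal (h \<mu>) < c) (at_right 0)"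
      unfolding eventually_at_right_field using zero_less_one by blast
  qed
  have eq: "perspective g v 0 = L"
    using tendsto_Lim[OF _ lim] by (simp add: perspective_def h_def)
  show "((\<lambda>\<mu>. ereal (\<mu> * g (v / \<mu>))) \<longlongrightarrow> perspective g v 0) (at_right 0)"
    using lim by (simp add: eq h_def)
  have "- \<infinity> < ereal (h 1)" by simp
  also have "\<dots> \<le> L" by (rule upper) simp
  finally show "perspective g v 0 > - \<infinity>" by (simp add: eq)
qed

definition Q1 ::
  "(real \<Rightarrow> real) \<Rightarrow> real ^ 'n \<Rightarrow> 'n set \<Rightarrow> (real \<times> (real ^ 'n) \<times> (real ^ 'n)) set" where
  "Q1 g a Iplus = {(t, x, z).
     (\<forall>i. z $ i \<in> {0, 1}) \<and>
     t \<ge> g (\<Sum>i\<in>UNIV. a $ i * x $ i) \<and>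
     (\<forall>i\<in>Iplus. x $ i \<ge> 0) \<and>
     (\<forall>i. x $ i * (1 - z $ i) = 0)}"

end

theory Submission imports Defs
begin

text \<open>
  Let \<open>R\<close> be the set of \<open>(t, x, z)\<close> for which suitable \<open>\<lambda>, \<tau>\<close> exist. The claim is that
  \<open>R\<close> is convex, closed, contains \<open>Q1\<close>, and lies in the closed convex hull of \<open>Q1\<close>.

  The recession value at scale \<open>0\<close> is handled by monotonicity. Since \<open>g\<close> is convex and
  \<open>g 0 = 0\<close>, the function \<open>l \<mapsto> l g(w / l)\<close> decreases in \<open>l > 0\<close>, and the perspective at
  \<open>\<lambda> \<ge> 0\<close> is its supremum over the scales \<open>\<lambda> + \<mu>\<close>, \<open>\<mu> > 0\<close>. Hence the extended-real
  inequality on \<open>t\<close> is equivalent to the real inequalities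
  \<open>\<Sum>\<^sub>i (\<lambda>\<^sub>i + \<mu>) g(w\<^sub>i / (\<lambda>\<^sub>i + \<mu>)) \<le> t\<close> for all \<open>\<mu> > 0\<close> (\<open>sum_perspective_le_iff\<close>). Each
  of these is jointly convex and continuous in all variables, so the set of \<open>(t, x, z, \<lambda>, \<tau>)\<close>
  is closed and convex (\<open>closed_lifted\<close>, \<open>convex_lifted\<close>), and its projection \<open>R\<close> is convex.

  The projection of a closed set is closed when the fibres are bounded. The multipliers \<open>\<lambda>\<close> are
  bounded, but \<open>\<tau>\<close> need not be. Put \<open>w\<^sub>i = a\<^sub>i (x\<^sub>i - \<tau>\<^sub>i)\<close>; these numbers add up to
  \<open>s = a \<bullet> x\<close>. If they have mixed signs, shrink those of the sign of \<open>s\<close> by a common factor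
  and replace the others by \<open>0\<close> so that the sum stays \<open>s\<close> (\<open>cancel_opposite_signs\<close>). This
  does not raise the cost (\<open>sum_persp_contract_le\<close>): subtracting from \<open>g\<close> a supporting line at
  \<open>0\<close> changes the cost by a multiple of \<open>s\<close> and leaves a nonnegative convex function
  vanishing at \<open>0\<close>, which can only decrease when its argument shrinks. So one may assume
  \<open>\<bar>w\<^sub>i\<bar> \<le> \<bar>s\<bar>\<close>, which bounds \<open>\<tau>\<close>. The same cancellation proves \<open>Q1 \<subseteq> R\<close>: starting
  from \<open>\<tau> = 0\<close> it produces \<open>w\<^sub>i = \<lambda>\<^sub>i s\<close> with \<open>\<lambda>\<^sub>i \<ge> 0\<close> of sum one (if \<open>s \<noteq> 0\<close>), at total
  cost \<open>\<Sum>\<^sub>i \<lambda>\<^sub>i g(s) = g(s)\<close>.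

  Conversely, a point of \<open>R\<close> with \<open>\<tau> = 0\<close> is, up to a small perturbation of \<open>\<lambda>\<close>, a convex
  combination with weights \<open>\<lambda>\<^sub>i\<close> of points whose \<open>x\<close> part has the single nonzero coordinate
  \<open>x\<^sub>i / \<lambda>\<^sub>i\<close>, and of a point with \<open>x\<close> part \<open>0\<close> (\<open>singleton_mixture_in_hull\<close>). A general
  \<open>\<tau>\<close> is added afterwards, since \<open>(0, \<tau>, 0)\<close> is a recession direction of the closed convex
  hull (\<open>add_cancelling_direction\<close>): moving along \<open>\<tau>\<close> leaves \<open>a \<bullet> x\<close> unchanged.
\<close>

section \<open>The perspective of a convex function at positive scale\<close>

definition persp :: "(real \<Rightarrow> real) \<Rightarrow> real \<Rightarrow> real \<Rightarrow> real" where
  "persp g w l = l * g (w / l)"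

text \<open>The mixture of the quotients \<open>w / l\<close> and \<open>w' / l'\<close> with weights proportional to \<open>u l\<close> and
  \<open>v l'\<close> is the quotient of the mixtures, so this is convexity of \<open>g\<close> at that point, scaled by
  the mixed scale.\<close>

lemma persp_jointly_convex:
  assumes "convex_on UNIV g" "0 < l" "0 < l'" "0 \<le> u" "0 \<le> v" "u + v = 1"
  shows "persp g (u * w + v * w') (u * l + v * l') \<le> u * persp g w l + v * persp g w' l'"
proof -
  define L where "L = u * l + v * l'"
  have L: "L > 0"
    using assms unfolding L_def by (cases "u = 0") (auto intro: add_pos_nonneg)
  have "(u * l / L) *\<^sub>R (w / l) + (v * l' / L) *\<^sub>R (w' / l') = (u * w + v * w') / L"
    using assms L by (simp add: field_simps)
  moreover have "u * l / L + v * l' / L = 1"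
    using L by (simp add: L_def flip: add_divide_distrib)
  ultimately have "g ((u * w + v * w') / L) \<le> (u * l / L) * g (w / l) + (v * l' / L) * g (w' / l')"
    using assms L
    by (metis UNIV_I convex_on_def divide_nonneg_pos less_imp_le mult_nonneg_nonneg)
  then have "L * g ((u * w + v * w') / L) \<le> L * ((u * l / L) * g (w / l) + (v * l' / L) * g (w' / l'))"
    using L by simp
  also have "\<dots> = u * persp g w l + v * persp g w' l'"
    using L by (simp add: persp_def field_simps)
  finally show ?thesis by (simp add: persp_def L_def)
qed

lemma persp_contract:
  assumes "convex_on UNIV g" "g 0 = 0" "0 < l" "0 \<le> c" "c \<le> 1"
  shows "persp g (c * w) l \<le> c * persp g w l"
  using persp_jointly_convex[OF assms(1,3,3), of c "1 - c" w 0] assms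
  by (simp add: persp_def algebra_simps)

text \<open>Enlarging the scale pulls the argument of \<open>g\<close> towards \<open>0\<close>, which is contraction at scale
  one. This monotonicity turns the limit that defines the recession value into a supremum.\<close>

lemma persp_antimono:
  assumes "convex_on UNIV g" "g 0 = 0" "0 < l" "l \<le> l'"
  shows "persp g w l' \<le> persp g w l"
proof -
  have "persp g ((l / l') * (w / l)) 1 \<le> (l / l') * persp g (w / l) 1"
    using assms by (intro persp_contract) auto
  then show ?thesis
    using assms by (simp add: persp_def field_simps)
qed

lemma isCont_convex:
  fixes g :: "real \<Rightarrow> real"
  assumes "convex_on UNIV g"
  shows "isCont g v"
  using convex_on_continuous[OF open_UNIV assms] by (simp add: continuous_on_eq_continuous_at)

text \<open>The shift by \<open>\<mu>\<close> treats zero and positive scales alike: at zero this is the defining limit of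
  the recession value, at positive scales it is continuity.\<close>

lemma persp_tendsto_perspective:
  assumes "convex_on UNIV g" "g 0 = 0" "0 \<le> l"
  shows "((\<lambda>\<mu>. ereal (persp g w (l + \<mu>))) \<longlongrightarrow> perspective g w l) (at_right 0)"
proof (cases "l = 0")
  case True
  then show ?thesis
    using perspective_0_limit(1)[OF assms(1,2)] by (simp add: persp_def)
next
  case False
  have "isCont (\<lambda>\<mu>. persp g w (l + \<mu>)) 0"
    unfolding persp_def using False
    by (intro continuous_intros isCont_o2[OF _ isCont_convex[OF assms(1)]]) auto
  then have "((\<lambda>\<mu>. persp g w (l + \<mu>)) \<longlongrightarrow> persp g w l) (at_right 0)"
    unfolding isCont_def using filterlim_at_split by fastforce
  then show ?thesis
    using False assms(3) by (simp add: perspective_def persp_def)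
qed

lemma persp_le_perspective:
  assumes "convex_on UNIV g" "g 0 = 0" "0 \<le> l" "0 < \<mu>"
  shows "ereal (persp g w (l + \<mu>)) \<le> perspective g w l"
proof (rule tendsto_lowerbound[OF persp_tendsto_perspective[OF assms(1-3)]])
  show "\<forall>\<^sub>F \<nu> in at_right 0. ereal (persp g w (l + \<mu>)) \<le> ereal (persp g w (l + \<nu>))"
    unfolding eventually_at_right_field using assms
    by (intro exI[of _ \<mu>]) (auto intro!: persp_antimono)
qed simp

lemma tendsto_sum_ereal_not_MInf:
  fixes f :: "'i \<Rightarrow> 'b \<Rightarrow> ereal"
  assumes "finite I" "\<And>i. i \<in> I \<Longrightarrow> (f i \<longlongrightarrow> L i) F" "\<And>i. i \<in> I \<Longrightarrow> L i \<noteq> -\<infinity>"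
  shows "((\<lambda>x. \<Sum>i\<in>I. f i x) \<longlongrightarrow> (\<Sum>i\<in>I. L i)) F \<and> (\<Sum>i\<in>I. L i) \<noteq> -\<infinity>"
  using assms by (induction I) (auto intro!: tendsto_add_ereal_nonneg)

text \<open>Each perspective value is the monotone limit of real numbers and never \<open>-\<infinity>\<close>, so the sum of the
  limits is the limit of the sums, and an upper bound on it is an upper bound on all of them. This
  removes the extended reals from the rest of the argument.\<close>

lemma sum_perspective_le_iff:
  fixes w l :: "'i \<Rightarrow> real"
  assumes "convex_on UNIV g" "g 0 = 0" "finite I" "\<And>i. i \<in> I \<Longrightarrow> 0 \<le> l i"
  shows "(\<Sum>i\<in>I. perspective g (w i) (l i)) \<le> ereal t \<longleftrightarrow>
    (\<forall>\<mu>>0. (\<Sum>i\<in>I. persp g (w i) (l i + \<mu>)) \<le> t)"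
proof
  assume le: "(\<Sum>i\<in>I. perspective g (w i) (l i)) \<le> ereal t"
  show "\<forall>\<mu>>0. (\<Sum>i\<in>I. persp g (w i) (l i + \<mu>)) \<le> t"
  proof (intro allI impI)
    fix \<mu> :: real assume "\<mu> > 0"
    then have "(\<Sum>i\<in>I. ereal (persp g (w i) (l i + \<mu>))) \<le> (\<Sum>i\<in>I. perspective g (w i) (l i))"
      by (intro sum_mono persp_le_perspective) (use assms in auto)
    then have "(\<Sum>i\<in>I. ereal (persp g (w i) (l i + \<mu>))) \<le> ereal t"
      using le by (rule order_trans)
    then show "(\<Sum>i\<in>I. persp g (w i) (l i + \<mu>)) \<le> t"
      by simp
  qed
next
  assume le: "\<forall>\<mu>>0. (\<Sum>i\<in>I. persp g (w i) (l i + \<mu>)) \<le> t"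
  have "perspective g (w i) (l i) \<noteq> -\<infinity>" if "i \<in> I" for i
    using persp_le_perspective[OF assms(1,2) assms(4)[OF that] zero_less_one, of "w i"] by auto
  then have "((\<lambda>\<mu>. \<Sum>i\<in>I. ereal (persp g (w i) (l i + \<mu>))) \<longlongrightarrow>
      (\<Sum>i\<in>I. perspective g (w i) (l i))) (at_right 0)"
    by (intro conjunct1[OF tendsto_sum_ereal_not_MInf] persp_tendsto_perspective assms)
  then show "(\<Sum>i\<in>I. perspective g (w i) (l i)) \<le> ereal t"
  proof (rule tendsto_upperbound)
    show "\<forall>\<^sub>F \<mu> in at_right 0. (\<Sum>i\<in>I. ereal (persp g (w i) (l i + \<mu>))) \<le> ereal t"
      unfolding eventually_at_right_field using le by (intro exI[of _ 1]) auto
  qed simp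
qed

section \<open>Cancelling terms of opposite sign\<close>

text \<open>If the sum \<open>s\<close> is positive, the positive entries add up to some \<open>P \<ge> s\<close>; scaling them by
  \<open>s / P\<close> and dropping the others keeps the sum. Contracting each entry towards \<open>0\<close>, rather than
  moving it arbitrarily, is what respects the sign constraints later on. The shares \<open>p\<close> give the
  bound \<open>\<bar>c i * w i\<bar> \<le> \<bar>s\<bar>\<close> and serve as the multipliers \<open>\<lambda>\<close> for points of \<open>Q1\<close>.\<close>

lemma cancel_opposite_signs:
  fixes w :: "'i \<Rightarrow> real"
  assumes "finite I"
  shows "\<exists>c p. (\<forall>i. 0 \<le> c i \<and> c i \<le> 1) \<and> (\<forall>i. 0 \<le> p i) \<and> sum p I \<le> 1 \<and>
    (\<forall>i\<in>I. c i * w i = p i * sum w I) \<and> (\<Sum>i\<in>I. c i * w i) = sum w I"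
proof -
  have pos: "\<exists>c p. (\<forall>i. 0 \<le> c i \<and> c i \<le> 1) \<and> (\<forall>i. 0 \<le> p i) \<and> sum p I \<le> 1 \<and>
      (\<forall>i\<in>I. c i * w i = p i * sum w I) \<and> (\<Sum>i\<in>I. c i * w i) = sum w I"
    if s: "sum w I > 0" for w :: "'i \<Rightarrow> real"
  proof -
    define P where "P = (\<Sum>i\<in>I. max (w i) 0)"
    have sP: "sum w I \<le> P"
      unfolding P_def by (intro sum_mono) auto
    define c where "c i = (if w i > 0 then sum w I / P else 0)" for i
    define p where "p i = max (w i) 0 / P" for i
    have cp: "c i * w i = p i * sum w I" for i
      by (simp add: c_def p_def max_def)
    have p1: "sum p I = 1"
      using s sP by (simp add: p_def P_def flip: sum_divide_distrib)
    have "(\<Sum>i\<in>I. c i * w i) = sum w I"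
      using p1 by (simp add: cp flip: sum_distrib_right)
    then show ?thesis
      using cp p1 s sP by (intro exI[of _ c] exI[of _ p]) (auto simp: c_def p_def)
  qed
  consider "sum w I > 0" | "sum w I = 0" | "sum (\<lambda>i. - w i) I > 0"
    by (force simp: sum_negf)
  then show ?thesis
  proof cases
    case 1
    then show ?thesis by (rule pos)
  next
    case 2
    then show ?thesis by (intro exI[of _ "\<lambda>_. 0"]) auto
  next
    case 3
    from pos[OF this] show ?thesis by (simp add: sum_negf)
  qed
qed

lemma convex_above_line_at_zero:
  fixes g :: "real \<Rightarrow> real"
  assumes "convex_on UNIV g" "g 0 = 0"
  obtains m where "\<And>v. m * v \<le> g v"
  using convex_le_Inf_differential[OF assms(1), of 0] assms(2) by auto

text \<open>Contracting a single entry may increase its cost, because \<open>g\<close> need not be minimal at \<open>0\<close>.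
  After subtracting a supporting line \<open>v \<mapsto> m * v\<close> it is, and the linear parts contribute the
  same amount to both sides because the entries have the same sum.\<close>

lemma sum_persp_contract_le:
  assumes "convex_on UNIV g" "g 0 = 0" "\<And>i. i \<in> I \<Longrightarrow> 0 < l i"
    and c: "\<And>i. i \<in> I \<Longrightarrow> 0 \<le> c i \<and> c i \<le> 1"
    and eq: "(\<Sum>i\<in>I. c i * w i) = sum w I"
  shows "(\<Sum>i\<in>I. persp g (c i * w i) (l i)) \<le> (\<Sum>i\<in>I. persp g (w i) (l i))"
proof -
  obtain m where m: "m * v \<le> g v" for v
    using convex_above_line_at_zero[OF assms(1,2)] by blast
  have "persp g (c i * w i) (l i) - m * (c i * w i) \<le> persp g (w i) (l i) - m * w i" if "i \<in> I" for i
  proof -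
    have "m * w i = l i * (m * (w i / l i))"
      using assms(3)[OF that] by simp
    also have "\<dots> \<le> persp g (w i) (l i)"
      unfolding persp_def by (rule mult_left_mono[OF m]) (use assms(3)[OF that] in simp)
    finally have "c i * (persp g (w i) (l i) - m * w i) \<le> persp g (w i) (l i) - m * w i"
      using c[OF that] by (simp add: mult_left_le_one_le)
    then show ?thesis
      using persp_contract[OF assms(1,2) assms(3)[OF that], of "c i" "w i"] c[OF that]
      by (simp add: algebra_simps)
  qed
  then have "(\<Sum>i\<in>I. persp g (c i * w i) (l i) - m * (c i * w i)) \<le> (\<Sum>i\<in>I. persp g (w i) (l i) - m * w i)"
    by (rule sum_mono)
  then show ?thesis
    using eq by (simp add: sum_subtractf flip: sum_distrib_left)
qed

section \<open>The extended formulation\<close>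

text \<open>The cost is bounded through the perturbed scales \<open>\<lambda>\<^sub>i + \<mu>\<close> so that only real inequalities
  between functions continuous on \<open>\<lambda> \<ge> 0\<close> occur. The pairing separates \<open>(t, x, z)\<close>, onto which
  the set is projected, from the auxiliary \<open>(\<lambda>, \<tau>)\<close>.\<close>

definition lifted ::
  "(real \<Rightarrow> real) \<Rightarrow> real ^ 'n \<Rightarrow> 'n set \<Rightarrow>
    ((real \<times> (real ^ 'n) \<times> (real ^ 'n)) \<times> ((real ^ 'n) \<times> (real ^ 'n))) set" where
  "lifted g a Iplus = {((t, x, z), (lam, tau)).
     (\<forall>\<mu>>0. (\<Sum>i\<in>UNIV. persp g (a $ i * (x $ i - tau $ i)) (lam $ i + \<mu>)) \<le> t) \<and>
     a \<bullet> tau = 0 \<and>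
     (\<forall>i\<in>Iplus. 0 \<le> tau $ i \<and> tau $ i \<le> x $ i) \<and>
     (\<forall>i. lam $ i \<le> z $ i \<and> z $ i \<le> 1) \<and>
     (\<forall>i. 0 \<le> lam $ i) \<and>
     (\<Sum>i\<in>UNIV. lam $ i) \<le> 1}"

lemma convex_lifted:
  fixes a :: "real ^ 'n"
  assumes "convex_on UNIV g"
  shows "convex (lifted g a Iplus)"
proof (rule convexI)
  fix p q :: "(real \<times> (real ^ 'n) \<times> (real ^ 'n)) \<times> ((real ^ 'n) \<times> (real ^ 'n))" and u v :: real
  assume p: "p \<in> lifted g a Iplus" and q: "q \<in> lifted g a Iplus"
    and uv: "0 \<le> u" "0 \<le> v" "u + v = 1"
  obtain t x z lam tau where p_eq: "p = ((t, x, z), (lam, tau))" by (metis surj_pair)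
  obtain t' x' z' lam' tau' where q_eq: "q = ((t', x', z'), (lam', tau'))" by (metis surj_pair)
  note P = p[unfolded p_eq lifted_def, simplified] and Q = q[unfolded q_eq lifted_def, simplified]
  have cost: "(\<Sum>i\<in>UNIV. persp g (a $ i * ((u * x $ i + v * x' $ i) - (u * tau $ i + v * tau' $ i)))
      (u * lam $ i + v * lam' $ i + \<mu>)) \<le> u * t + v * t'" if "\<mu> > 0" for \<mu>
  proof -
    let ?w = "\<lambda>i. a $ i * (x $ i - tau $ i)" and ?w' = "\<lambda>i. a $ i * (x' $ i - tau' $ i)"
    have "persp g (a $ i * ((u * x $ i + v * x' $ i) - (u * tau $ i + v * tau' $ i)))
        (u * lam $ i + v * lam' $ i + \<mu>)
      \<le> u * persp g (?w i) (lam $ i + \<mu>) + v * persp g (?w' i) (lam' $ i + \<mu>)" for i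
    proof -
      have "u * (lam $ i + \<mu>) + v * (lam' $ i + \<mu>) = u * lam $ i + v * lam' $ i + (u + v) * \<mu>"
        by (simp add: algebra_simps)
      then have "u * lam $ i + v * lam' $ i + \<mu> = u * (lam $ i + \<mu>) + v * (lam' $ i + \<mu>)"
        using uv(3) by simp
      moreover have "a $ i * ((u * x $ i + v * x' $ i) - (u * tau $ i + v * tau' $ i)) = u * ?w i + v * ?w' i"
        by (simp add: algebra_simps)
      moreover have "0 < lam $ i + \<mu>" "0 < lam' $ i + \<mu>"
        using P Q that by (simp_all add: add_nonneg_pos)
      ultimately show ?thesis
        using persp_jointly_convex[OF assms _ _ uv] by metis
    qed
    then have "(\<Sum>i\<in>UNIV. persp g (a $ i * ((u * x $ i + v * x' $ i) - (u * tau $ i + v * tau' $ i)))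
        (u * lam $ i + v * lam' $ i + \<mu>))
      \<le> u * (\<Sum>i\<in>UNIV. persp g (?w i) (lam $ i + \<mu>)) + v * (\<Sum>i\<in>UNIV. persp g (?w' i) (lam' $ i + \<mu>))"
      by (simp add: sum_distrib_left sum_mono flip: sum.distrib)
    also have "\<dots> \<le> u * t + v * t'"
      using P Q that uv by (intro add_mono mult_left_mono) auto
    finally show ?thesis .
  qed
  have "u * z $ i + v * z' $ i \<le> 1" for i
    using P Q uv convex_bound_le[of "z $ i" 1 "z' $ i" u v] by auto
  moreover have "(\<Sum>i\<in>UNIV. u * lam $ i + v * lam' $ i) \<le> 1"
    using P Q uv convex_bound_le[of "\<Sum>i\<in>UNIV. lam $ i" 1 "\<Sum>i\<in>UNIV. lam' $ i" u v]
    by (auto simp: sum.distrib sum_distrib_left)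
  ultimately show "u *\<^sub>R p + v *\<^sub>R q \<in> lifted g a Iplus"
    using cost P Q uv
    by (auto simp: p_eq q_eq lifted_def inner_add_right add_mono mult_left_mono)
qed

text \<open>The constraint \<open>\<lambda> \<ge> 0\<close> belongs to the closed set \<open>S\<close>, on which the scales \<open>\<lambda>\<^sub>i + \<mu>\<close> do not
  vanish; each cost bound is therefore a closed condition relative to \<open>S\<close>.\<close>

lemma closed_lifted:
  fixes a :: "real ^ 'n"
  assumes "convex_on UNIV g"
  shows "closed (lifted g a Iplus)"
proof -
  let ?T = "UNIV :: ((real \<times> (real ^ 'n) \<times> (real ^ 'n)) \<times> ((real ^ 'n) \<times> (real ^ 'n))) set"
  define S where "S = {y \<in> ?T. a \<bullet> snd (snd y) = 0 \<and>
     (\<forall>i. i \<in> Iplus \<longrightarrow> 0 \<le> snd (snd y) $ i \<and> snd (snd y) $ i \<le> fst (snd (fst y)) $ i) \<and>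
     (\<forall>i. fst (snd y) $ i \<le> snd (snd (fst y)) $ i \<and> snd (snd (fst y)) $ i \<le> 1) \<and>
     (\<forall>i. 0 \<le> fst (snd y) $ i) \<and> (\<Sum>i\<in>UNIV. fst (snd y) $ i) \<le> 1}"
  have "closed S"
    unfolding S_def
    by (simp, intro closed_Collect_conj closed_Collect_all closed_Collect_imp closed_Collect_le
        closed_Collect_eq open_Collect_const continuous_intros)
  define F where "F \<mu> = {y \<in> S. (\<Sum>i\<in>UNIV. persp g (a $ i * (fst (snd (fst y)) $ i - snd (snd y) $ i))
       (fst (snd y) $ i + \<mu>)) \<le> fst (fst y)}" for \<mu>
  have "closed (F \<mu>)" if "\<mu> > 0" for \<mu>
    unfolding F_def
  proof (rule continuous_on_closed_Collect_le[OF _ _ \<open>closed S\<close>])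
    have nz: "fst (snd y) $ i + \<mu> \<noteq> 0" if "y \<in> S" for y i
    proof -
      have "0 \<le> fst (snd y) $ i" using that by (simp add: S_def)
      then show ?thesis using \<open>\<mu> > 0\<close> by linarith
    qed
    have cg: "continuous_on UNIV g"
      using convex_on_continuous[OF open_UNIV assms] .
    show "continuous_on S (\<lambda>y. \<Sum>i\<in>UNIV. persp g (a $ i * (fst (snd (fst y)) $ i - snd (snd y) $ i))
       (fst (snd y) $ i + \<mu>))"
      unfolding persp_def using nz
      by (intro continuous_intros continuous_on_compose2[OF cg]) auto
  qed (intro continuous_intros)
  then have "closed (\<Inter>\<mu>\<in>{0<..}. F \<mu>)"
    by (intro closed_INT) auto
  moreover have "(\<Inter>\<mu>\<in>{0<..}. F \<mu>) = lifted g a Iplus"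
    by (auto simp: F_def S_def lifted_def intro: zero_less_one)
  ultimately show ?thesis by simp
qed

text \<open>A convergent sequence in the projection is bounded, so its lifts are bounded too and subconverge
  to a lift of the limit.\<close>

lemma closed_fst_image_bounded_fibres:
  fixes E :: "('a::euclidean_space \<times> 'b::euclidean_space) set"
  assumes "closed E" and bd: "\<And>R. \<exists>B. \<forall>(p, q)\<in>E. norm p \<le> R \<longrightarrow> norm q \<le> B"
  shows "closed (fst ` E)"
  unfolding closed_sequential_limits
proof (intro allI impI, elim conjE)
  fix X l assume X: "\<forall>n. X n \<in> fst ` E" and lim: "X \<longlonglongrightarrow> l"
  from X have "\<forall>n. \<exists>q. (X n, q) \<in> E" by force
  then obtain Y where Y: "(X n, Y n) \<in> E" for n by metis
  obtain R where R: "norm (X n) \<le> R" for n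
    using convergent_imp_Bseq[of X] lim unfolding convergent_def Bseq_def by blast
  obtain B where B: "norm (Y n) \<le> B" for n
    using bd[of R] Y R by blast
  have "compact (cball (0::'b) B)" by simp
  then obtain q r where r: "strict_mono r" and q: "(Y \<circ> r) \<longlonglongrightarrow> q"
    unfolding compact_def using B by (metis mem_cball_0)
  have "(\<lambda>n. ((X \<circ> r) n, (Y \<circ> r) n)) \<longlonglongrightarrow> (l, q)"
    by (intro tendsto_Pair q LIMSEQ_subseq_LIMSEQ[OF lim r])
  then have "(l, q) \<in> E"
    by (rule closed_sequentially[OF assms(1), rotated]) (simp add: Y)
  then show "l \<in> fst ` E" by force
qed

text \<open>For \<open>i\<close> outside \<open>Iplus\<close> no individual bound is imposed on \<open>\<tau>\<^sub>i\<close>; cancelling opposite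
  signs among the terms \<open>a\<^sub>i (x\<^sub>i - \<tau>\<^sub>i)\<close> yields another admissible \<open>\<tau>\<close> with the same \<open>\<lambda>\<close>
  for which these terms are controlled by \<open>x\<close>. The constraints on \<open>Iplus\<close> survive because
  \<open>x\<^sub>i - \<tau>\<^sub>i\<close> only shrinks towards \<open>0\<close>.\<close>

lemma lifted_cancel:
  assumes g: "convex_on UNIV g" "g 0 = 0"
    and mem: "((t, x, z), (lam, tau)) \<in> lifted g a Iplus"
  obtains tau' where "((t, x, z), (lam, tau')) \<in> lifted g a Iplus"
    "\<And>i. \<bar>a $ i * (x $ i - tau' $ i)\<bar> \<le> \<bar>a \<bullet> x\<bar>"
proof -
  note M = mem[unfolded lifted_def, simplified]
  define w where "w i = a $ i * (x $ i - tau $ i)" for i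
  have sw: "sum w UNIV = a \<bullet> x"
    using M by (simp add: w_def inner_vec_def right_diff_distrib sum_subtractf)
  obtain c p where c: "\<And>i. 0 \<le> c i \<and> c i \<le> 1" and p: "\<And>i. 0 \<le> p i" "sum p UNIV \<le> 1"
    and cp: "\<And>i. c i * w i = p i * (a \<bullet> x)" and cw: "(\<Sum>i\<in>UNIV. c i * w i) = sum w UNIV"
    using cancel_opposite_signs[of UNIV w, OF finite] unfolding sw by blast
  define tau' where "tau' = (\<chi> i. x $ i - c i * (x $ i - tau $ i))"
  have w': "a $ i * (x $ i - tau' $ i) = c i * w i" for i
    by (simp add: tau'_def w_def)
  have "(\<Sum>i\<in>UNIV. a $ i * (x $ i - tau' $ i)) = a \<bullet> x"
    using cw sw by (simp add: w')
  then have orth: "a \<bullet> tau' = 0"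
    by (simp add: inner_vec_def right_diff_distrib sum_subtractf)
  have cost: "(\<Sum>i\<in>UNIV. persp g (a $ i * (x $ i - tau' $ i)) (lam $ i + \<mu>)) \<le> t" if "\<mu> > 0" for \<mu>
  proof -
    have "(\<Sum>i\<in>UNIV. persp g (c i * w i) (lam $ i + \<mu>)) \<le> (\<Sum>i\<in>UNIV. persp g (w i) (lam $ i + \<mu>))"
      using M that c cw by (intro sum_persp_contract_le[OF g]) (auto simp: add_nonneg_pos)
    also have "\<dots> \<le> t"
      using M that by (simp add: w_def)
    finally show ?thesis by (simp add: w')
  qed
  have box: "0 \<le> tau' $ i \<and> tau' $ i \<le> x $ i" if "i \<in> Iplus" for i
  proof -
    have "0 \<le> x $ i - tau $ i" "0 \<le> tau $ i" using M that by auto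
    moreover from this have "c i * (x $ i - tau $ i) \<le> x $ i - tau $ i" "0 \<le> c i * (x $ i - tau $ i)"
      using c[of i] by (auto simp: mult_left_le_one_le)
    ultimately show ?thesis by (simp add: tau'_def)
  qed
  have "((t, x, z), (lam, tau')) \<in> lifted g a Iplus"
    using M cost orth box by (simp add: lifted_def)
  moreover have "\<bar>a $ i * (x $ i - tau' $ i)\<bar> \<le> \<bar>a \<bullet> x\<bar>" for i
  proof -
    have "p i \<le> sum p UNIV"
      using p(1) by (intro member_le_sum) auto
    then show ?thesis
      using p by (simp add: w' cp abs_mult mult_left_le_one_le)
  qed
  ultimately show ?thesis by (rule that)
qed

text \<open>Restricting the lifted set to bounded terms \<open>a\<^sub>i (x\<^sub>i - \<tau>\<^sub>i)\<close> does not change the projection,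
  and as \<open>a\<^sub>i \<noteq> 0\<close> it makes the fibres bounded. The restricted set need not be convex;
  it serves only to show closedness.\<close>

lemma closed_fst_lifted:
  fixes a :: "real ^ 'n"
  assumes g: "convex_on UNIV g" "g 0 = 0" and a: "\<And>i. a $ i \<noteq> 0"
  shows "closed (fst ` lifted g a Iplus)"
proof -
  define E where "E = lifted g a Iplus \<inter> {y. \<forall>i. \<bar>a $ i * (fst (snd (fst y)) $ i - snd (snd y) $ i)\<bar>
    \<le> \<bar>a \<bullet> fst (snd (fst y))\<bar>}"
  have "closed E"
    unfolding E_def
    by (intro closed_Int closed_lifted g closed_Collect_all closed_Collect_le continuous_intros)
  moreover have "\<exists>B. \<forall>(p, q)\<in>E. norm p \<le> R \<longrightarrow> norm q \<le> B" for R
  proof -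
    define B where "B = (\<Sum>i\<in>(UNIV::'n set). 1) + (\<Sum>i\<in>UNIV. R + norm a * R / \<bar>a $ i\<bar>)"
    have "norm (lam, tau) \<le> B" if mem: "((t, x, z), (lam, tau)) \<in> E" and R: "norm (t, x, z) \<le> R"
      for t :: real and x z lam tau :: "real ^ 'n"
    proof -
      note M = mem[unfolded E_def lifted_def, simplified]
      have xR: "norm x \<le> R"
        using R norm_snd_le[of "(x, z)" t] norm_fst_le[of x z] by linarith
      have "\<bar>lam $ i\<bar> \<le> 1" for i
        using M by (metis abs_of_nonneg order_trans)
      then have "norm lam \<le> (\<Sum>i\<in>(UNIV::'n set). 1)"
        by (intro order_trans[OF norm_le_l1_cart] sum_mono)
      moreover have "\<bar>tau $ i\<bar> \<le> R + norm a * R / \<bar>a $ i\<bar>" for i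
      proof -
        have "\<bar>a $ i\<bar> * \<bar>x $ i - tau $ i\<bar> \<le> \<bar>a \<bullet> x\<bar>"
          using M by (metis abs_mult)
        also have "\<dots> \<le> norm a * R"
          using Cauchy_Schwarz_ineq2[of a x] xR by (meson mult_left_mono norm_ge_zero order_trans)
        finally have "\<bar>x $ i - tau $ i\<bar> \<le> norm a * R / \<bar>a $ i\<bar>"
          using a[of i] by (simp add: field_simps)
        then show ?thesis
          using component_le_norm_cart[of x i] xR by linarith
      qed
      then have "norm tau \<le> (\<Sum>i\<in>UNIV. R + norm a * R / \<bar>a $ i\<bar>)"
        by (intro order_trans[OF norm_le_l1_cart] sum_mono)
      ultimately show ?thesis
        using norm_Pair_le[of lam tau] unfolding B_def by linarith
    qed
    then show ?thesis by (intro exI[of _ B]) fast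
  qed
  ultimately have "closed (fst ` E)"
    by (rule closed_fst_image_bounded_fibres)
  moreover have "fst ` lifted g a Iplus \<subseteq> fst ` E"
  proof (clarsimp)
    fix t and x z lam tau :: "real ^ 'n"
    assume "((t, x, z), (lam, tau)) \<in> lifted g a Iplus"
    from lifted_cancel[OF g this] obtain tau' where "((t, x, z), (lam, tau')) \<in> lifted g a Iplus"
      "\<And>i. \<bar>a $ i * (x $ i - tau' $ i)\<bar> \<le> \<bar>a \<bullet> x\<bar>"
      by blast
    then have "((t, x, z), (lam, tau')) \<in> E"
      by (simp add: E_def)
    then show "(t, x, z) \<in> fst ` E"
      by (metis fst_conv imageI)
  qed
  then have "fst ` E = fst ` lifted g a Iplus"
    by (auto simp: E_def)
  ultimately show ?thesis by simp
qed

section \<open>The relaxation contains the mixed-integer set\<close>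

text \<open>Cancellation starting from \<open>\<tau> = 0\<close> makes the terms \<open>a\<^sub>i (x\<^sub>i - \<tau>\<^sub>i)\<close> equal to \<open>\<lambda>\<^sub>i s\<close> with
  \<open>s = a \<bullet> x\<close>, where the cost of term \<open>i\<close> is \<open>\<lambda>\<^sub>i g(s)\<close>. Where \<open>z\<^sub>i = 0\<close> also \<open>x\<^sub>i = 0\<close>, which
  forces \<open>\<lambda>\<^sub>i = 0\<close>.\<close>

lemma Q1_subset_fst_lifted:
  fixes a :: "real ^ 'n"
  assumes g: "convex_on UNIV g" "g 0 = 0"
  shows "Q1 g a Iplus \<subseteq> fst ` lifted g a Iplus"
proof (clarify)
  fix t and x z :: "real ^ 'n"
  assume mem: "(t, x, z) \<in> Q1 g a Iplus"
  note M = mem[unfolded Q1_def, simplified]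
  define w where "w i = a $ i * x $ i" for i
  define s where "s = sum w UNIV"
  obtain c p where c: "\<And>i. 0 \<le> c i \<and> c i \<le> 1" and p: "\<And>i. 0 \<le> p i" "sum p UNIV \<le> 1"
    and cp: "\<And>i. c i * w i = p i * s" and cw: "(\<Sum>i\<in>UNIV. c i * w i) = s"
    using cancel_opposite_signs[of UNIV w, OF finite] unfolding s_def by blast
  \<comment> \<open>For \<open>s = 0\<close> the shares \<open>p\<close> are arbitrary and could exceed \<open>z\<close>; then \<open>\<lambda> = 0\<close> works
    since all terms vanish.\<close>
  define lam where "lam = (\<chi> i. if s = 0 then 0 else p i)"
  define tau where "tau = (\<chi> i. (1 - c i) * x $ i)"
  have w': "a $ i * (x $ i - tau $ i) = lam $ i * s" for i
    using cp[of i] by (simp add: tau_def lam_def w_def algebra_simps)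
  have lam0: "0 \<le> lam $ i" for i using p by (simp add: lam_def)
  have lams: "(\<Sum>i\<in>UNIV. lam $ i) * s = s"
    using cw by (cases "s = 0") (simp_all add: cp lam_def flip: sum_distrib_right)
  have cost: "(\<Sum>i\<in>UNIV. persp g (a $ i * (x $ i - tau $ i)) (lam $ i + \<mu>)) \<le> t" if "\<mu> > 0" for \<mu>
  proof -
    have "persp g (lam $ i * s) (lam $ i + \<mu>) \<le> lam $ i * g s" for i
    proof -
      have "0 < lam $ i + \<mu>" using lam0[of i] that by linarith
      then have "persp g ((lam $ i / (lam $ i + \<mu>)) * s) 1 \<le> lam $ i / (lam $ i + \<mu>) * persp g s 1"
        using lam0[of i] that by (intro persp_contract g) auto
      then show ?thesis
        using \<open>0 < lam $ i + \<mu>\<close> by (simp add: persp_def field_simps)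
    qed
    then have "(\<Sum>i\<in>UNIV. persp g (a $ i * (x $ i - tau $ i)) (lam $ i + \<mu>)) \<le> (\<Sum>i\<in>UNIV. lam $ i * g s)"
      unfolding w' by (rule sum_mono)
    also have "\<dots> = g s"
      using lams g(2) by (cases "s = 0") (simp_all flip: sum_distrib_right)
    also have "\<dots> \<le> t"
      using M by (simp add: s_def w_def)
    finally show ?thesis .
  qed
  have "(\<Sum>i\<in>UNIV. a $ i * (x $ i - tau $ i)) = s"
    using lams by (simp add: w' flip: sum_distrib_right)
  then have orth: "a \<bullet> tau = 0"
    by (simp add: inner_vec_def right_diff_distrib sum_subtractf s_def w_def)
  have box: "0 \<le> tau $ i \<and> tau $ i \<le> x $ i" if "i \<in> Iplus" for i
    using M that c[of i] by (auto simp: tau_def mult_left_le_one_le)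
  have plam: "lam $ i \<le> p i" for i using p by (simp add: lam_def)
  have lam1: "(\<Sum>i\<in>UNIV. lam $ i) \<le> 1"
    using sum_mono[of UNIV "\<lambda>i. lam $ i" p] plam p(2) by simp
  have z: "lam $ i \<le> z $ i \<and> z $ i \<le> 1" for i
  proof (cases "z $ i = 0")
    case True
    moreover have "x $ i * (1 - z $ i) = 0" using mem unfolding Q1_def by blast
    ultimately have "x $ i = 0" by simp
    then have "lam $ i = 0" using w'[of i] by (auto simp: tau_def lam_def)
    with True show ?thesis by simp
  next
    case False
    then have "z $ i = 1" using M by blast
    moreover have "lam $ i \<le> (\<Sum>i\<in>UNIV. lam $ i)"
      using lam0 by (intro member_le_sum) auto
    ultimately show ?thesis using lam1 by simp
  qed
  have "((t, x, z), (lam, tau)) \<in> lifted g a Iplus"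
    using cost orth box lam0 lam1 z by (simp add: lifted_def)
  then show "(t, x, z) \<in> fst ` lifted g a Iplus" by force
qed

section \<open>The mixed-integer set generates the relaxation\<close>

text \<open>A face of the unit cube is the convex hull of its vertices: a fractional coordinate is removed by
  writing the point as a mixture of the two points where that coordinate is rounded.\<close>

lemma convex_contains_cube_face:
  fixes C :: "(real ^ 'n) set"
  assumes "convex C"
    and vert: "\<And>u. \<forall>i. u $ i \<in> {0, 1} \<Longrightarrow> \<forall>i\<in>J. u $ i = 1 \<Longrightarrow> u \<in> C"
    and u: "\<And>i. 0 \<le> u $ i \<and> u $ i \<le> 1" "\<And>i. i \<in> J \<Longrightarrow> u $ i = 1"
  shows "u \<in> C"
proof -
  have "u \<in> C"
    if "finite S" "\<forall>i. i \<notin> S \<longrightarrow> u $ i \<in> {0, 1}" "\<forall>i. 0 \<le> u $ i \<and> u $ i \<le> 1" "\<forall>i\<in>J. u $ i = 1"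
    for S and u :: "real ^ 'n"
    using that
  proof (induction S arbitrary: u rule: finite_induct)
    case empty
    then show ?case by (intro vert) auto
  next
    case (insert k S)
    define v where "v r = (\<chi> i. if i = k then r else u $ i)" for r
    show ?case
    proof (cases "u $ k = 1")
      case True
      have "u $ i \<in> {0, 1}" if "i \<notin> S" for i
        using insert.prems(1) True that by (cases "i = k") auto
      then show ?thesis
        using insert.prems by (intro insert.IH) auto
    next
      case False
      have "v 0 \<in> C" "v 1 \<in> C"
        by (rule insert.IH; use insert.prems False in \<open>auto simp: v_def\<close>)+
      then have "(1 - u $ k) *\<^sub>R v 0 + (u $ k) *\<^sub>R v 1 \<in> C"
        using insert.prems by (intro convexD[OF \<open>convex C\<close>]) auto
      also have "(1 - u $ k) *\<^sub>R v 0 + (u $ k) *\<^sub>R v 1 = u"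
        by (auto simp: vec_eq_iff v_def algebra_simps)
      finally show ?thesis .
    qed
  qed
  from this[of UNIV u] u show ?thesis by auto
qed

text \<open>For fixed \<open>t\<close> and \<open>x\<close>, the indicators admitted by \<open>Q1\<close> are the vertices of the cube face on
  which coordinates in the support of \<open>x\<close> equal one.\<close>

lemma relaxed_indicator_in_hull:
  fixes a x u :: "real ^ 'n"
  assumes "g (a \<bullet> x) \<le> t" "\<And>i. i \<in> Iplus \<Longrightarrow> 0 \<le> x $ i"
    and "\<And>i. 0 \<le> u $ i \<and> u $ i \<le> 1" "\<And>i. x $ i \<noteq> 0 \<Longrightarrow> u $ i = 1"
  shows "(t, x, u) \<in> convex hull Q1 g a Iplus"
proof -
  define C where "C = {u. (t, x, u) \<in> convex hull Q1 g a Iplus}"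
  have "convex C"
  proof (rule convexI)
    fix b c :: "real ^ 'n" and p q :: real
    assume "b \<in> C" "c \<in> C" and pq: "0 \<le> p" "0 \<le> q" "p + q = 1"
    then have "p *\<^sub>R (t, x, b) + q *\<^sub>R (t, x, c) \<in> convex hull Q1 g a Iplus"
      unfolding C_def by (intro convexD[OF convex_convex_hull]) auto
    moreover have "p * t + q * t = t" "p *\<^sub>R x + q *\<^sub>R x = x"
      using pq(3) by (simp_all flip: distrib_right scaleR_left_distrib)
    ultimately show "p *\<^sub>R b + q *\<^sub>R c \<in> C"
      by (simp add: C_def)
  qed
  then have "u \<in> C"
  proof (rule convex_contains_cube_face[where J = "{i. x $ i \<noteq> 0}"])
    fix v :: "real ^ 'n"
    assume "\<forall>i. v $ i \<in> {0, 1}" "\<forall>i\<in>{i. x $ i \<noteq> 0}. v $ i = 1"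
    then have "(t, x, v) \<in> Q1 g a Iplus"
      using assms(1,2) by (auto simp: Q1_def inner_vec_def)
    then show "v \<in> C" by (simp add: C_def hull_inc)
  qed (use assms in auto)
  then show ?thesis by (simp add: C_def)
qed

lemma sum_UNIV_option:
  fixes f :: "'i::finite option \<Rightarrow> 'b::comm_monoid_add"
  shows "sum f UNIV = f None + (\<Sum>i\<in>UNIV. f (Some i))"
  by (simp add: UNIV_option_conv sum.reindex)

text \<open>The combination uses, with weight \<open>p i\<close>, the point with \<open>x\<close> part \<open>v i\<close> in coordinate \<open>i\<close> and
  \<open>0\<close> elsewhere, and with the remaining weight a point with \<open>x\<close> part \<open>0\<close>. The indicator of
  coordinate \<open>i\<close> must be one at the \<open>i\<close>-th point, which accounts for \<open>p i\<close> of \<open>z $ i\<close>; elsewhere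
  it is free, and the constant value \<open>r i\<close> below makes up the difference.\<close>

lemma singleton_mixture_in_hull:
  fixes a z :: "real ^ 'n" and p v :: "'n \<Rightarrow> real"
  assumes g0: "g 0 = 0"
    and p: "\<And>i. 0 \<le> p i" "sum p UNIV \<le> 1"
    and z: "\<And>i. p i \<le> z $ i" "\<And>i. z $ i \<le> 1"
    and v: "\<And>i. i \<in> Iplus \<Longrightarrow> 0 \<le> v i"
    and t: "(\<Sum>i\<in>UNIV. p i * g (a $ i * v i)) \<le> t"
  shows "(t, (\<chi> i. p i * v i), z) \<in> convex hull Q1 g a Iplus"
proof -
  \<comment> \<open>The slack in \<open>t\<close>, added to every point of the combination.\<close>
  define d where "d = t - (\<Sum>i\<in>UNIV. p i * g (a $ i * v i))"
  define r where "r i = (z $ i - p i) / (1 - p i)" for i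
  have p1: "p i \<le> 1" for i using z(1)[of i] z(2)[of i] by linarith
  have r: "0 \<le> r i" "r i \<le> 1" for i
    using z[of i] p1[of i] by (auto simp: r_def divide_le_eq_1)
  have mix: "p i + (1 - p i) * r i = z $ i" for i
    using z[of i] by (cases "p i = 1") (auto simp: r_def)
  \<comment> \<open>The points are indexed by \<open>'n option\<close>, with \<open>None\<close> for the one whose \<open>x\<close> part is \<open>0\<close>.\<close>
  define q where "q k = (case k of None \<Rightarrow> 1 - sum p UNIV | Some i \<Rightarrow> p i)" for k
  define X where "X k = (case k of None \<Rightarrow> 0 | Some i \<Rightarrow> axis i (v i))" for k
  define U where "U k = (\<chi> i. if k = Some i then 1 else r i)" for k
  define y where "y k = (g (a \<bullet> X k) + d, X k, U k)" for k
  have aX: "a \<bullet> X (Some i) = a $ i * v i" for i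
    by (simp add: X_def inner_axis)
  have "y k \<in> convex hull Q1 g a Iplus" for k
    unfolding y_def
  proof (rule relaxed_indicator_in_hull)
    show "g (a \<bullet> X k) \<le> g (a \<bullet> X k) + d" using t by (simp add: d_def)
    show "0 \<le> X k $ i" if "i \<in> Iplus" for i
      using v[OF that] by (auto simp: X_def axis_def split: option.split)
    show "0 \<le> U k $ i \<and> U k $ i \<le> 1" for i
      using r by (simp add: U_def)
    show "U k $ i = 1" if "X k $ i \<noteq> 0" for i
      using that by (auto simp: X_def U_def axis_def split: option.splits if_splits)
  qed
  then have "(\<Sum>k\<in>UNIV. q k *\<^sub>R y k) \<in> convex hull Q1 g a Iplus"
    using p by (intro convex_sum convex_convex_hull)
      (auto simp: sum_UNIV_option q_def split: option.split)
  also have "(\<Sum>k\<in>UNIV. q k *\<^sub>R y k) = (t, (\<chi> i. p i * v i), z)"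
  proof (intro prod_eqI)
    have "(\<Sum>k\<in>UNIV. q k * (g (a \<bullet> X k) + d)) = (\<Sum>k\<in>UNIV. q k * g (a \<bullet> X k)) + sum q UNIV * d"
      by (simp add: distrib_left sum.distrib sum_distrib_right)
    also have "sum q UNIV = 1"
      by (simp add: sum_UNIV_option q_def)
    also have "(\<Sum>k\<in>UNIV. q k * g (a \<bullet> X k)) = (\<Sum>i\<in>UNIV. p i * g (a $ i * v i))"
      by (simp only: sum_UNIV_option aX) (simp add: q_def X_def g0)
    finally show "fst (\<Sum>k\<in>UNIV. q k *\<^sub>R y k) = fst (t, (\<chi> i. p i * v i), z)"
      by (simp add: fst_sum y_def d_def)
    show "fst (snd (\<Sum>k\<in>UNIV. q k *\<^sub>R y k)) = fst (snd (t, (\<chi> i. p i * v i), z))"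
      by (simp add: vec_eq_iff fst_sum snd_sum y_def sum_UNIV_option X_def q_def axis_def
          if_distrib cong: if_cong)
    have "(\<Sum>k\<in>UNIV. q k * U k $ i) = z $ i" for i
    proof -
      have "(\<Sum>j\<in>UNIV. p j * (if j = i then 1 else r i))
          = (\<Sum>j\<in>UNIV. p j * r i + (if j = i then p j * (1 - r i) else 0))"
        by (intro sum.cong) (auto simp: algebra_simps)
      also have "\<dots> = sum p UNIV * r i + p i * (1 - r i)"
        by (simp add: sum.distrib sum_distrib_right)
      finally have "(\<Sum>k\<in>UNIV. q k * U k $ i) = (1 - sum p UNIV) * r i + (sum p UNIV * r i + p i * (1 - r i))"
        by (simp add: sum_UNIV_option q_def U_def)
      also have "\<dots> = z $ i"
        using mix[of i] by (simp add: algebra_simps)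
      finally show ?thesis .
    qed
    then show "snd (snd (\<Sum>k\<in>UNIV. q k *\<^sub>R y k)) = snd (snd (t, (\<chi> i. p i * v i), z))"
      by (simp add: vec_eq_iff snd_sum y_def)
  qed
  finally show ?thesis .
qed

text \<open>A zero multiplier cannot be the weight of a point carrying \<open>y $ i \<noteq> 0\<close>. Weights proportional to
  \<open>\<lambda>\<^sub>i + \<mu>\<close> are positive, the cost at these scales is still at most \<open>t\<close>, and the points so obtained
  converge as \<open>\<mu>\<close> tends to \<open>0\<close>.\<close>

lemma perspective_point_in_closure:
  fixes a y z lam :: "real ^ 'n"
  assumes g0: "g 0 = 0"
    and cost: "\<And>\<mu>. \<mu> > 0 \<Longrightarrow> (\<Sum>i\<in>UNIV. persp g (a $ i * y $ i) (lam $ i + \<mu>)) \<le> t"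
    and lam: "\<And>i. 0 \<le> lam $ i" "(\<Sum>i\<in>UNIV. lam $ i) \<le> 1"
    and z: "\<And>i. lam $ i \<le> z $ i" "\<And>i. z $ i \<le> 1"
    and y: "\<And>i. i \<in> Iplus \<Longrightarrow> 0 \<le> y $ i"
  shows "(t, y, z) \<in> closure (convex hull Q1 g a Iplus)"
proof -
  \<comment> \<open>Normalises the weights: the perturbed multipliers add up to at most \<open>D \<mu>\<close>. As \<open>D \<mu> \<ge> 1 + \<mu>\<close>,
    the perturbed \<open>z\<close> stays below one.\<close>
  define D where "D \<mu> = 1 + real CARD('n) * \<mu>" for \<mu> :: real
  define P where "P \<mu> = (t / D \<mu>, (1 / D \<mu>) *\<^sub>R y, (1 / D \<mu>) *\<^sub>R (z + \<mu> *\<^sub>R 1))" for \<mu>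
  have mem: "P \<mu> \<in> closure (convex hull Q1 g a Iplus)" if \<mu>: "\<mu> > 0" for \<mu>
  proof -
    have "1 \<le> real CARD('n)" by (simp add: Suc_leI)
    then have D: "1 + \<mu> \<le> D \<mu>" using \<mu> by (simp add: D_def)
    then have D0: "D \<mu> > 0" using \<mu> by linarith
    have l: "0 < lam $ i + \<mu>" for i using lam(1)[of i] \<mu> by linarith
    define p where "p i = (lam $ i + \<mu>) / D \<mu>" for i
    define v where "v i = y $ i / (lam $ i + \<mu>)" for i
    have "(t / D \<mu>, (\<chi> i. p i * v i), (1 / D \<mu>) *\<^sub>R (z + \<mu> *\<^sub>R 1)) \<in> convex hull Q1 g a Iplus"
    proof (rule singleton_mixture_in_hull)
      show "g 0 = 0" by (fact g0)
      show "0 \<le> p i" for i using l[of i] D0 by (simp add: p_def)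
      have "(\<Sum>i\<in>UNIV. lam $ i + \<mu>) \<le> D \<mu>"
        using lam(2) by (simp add: sum.distrib D_def)
      then show "sum p UNIV \<le> 1"
        using D0 by (simp add: p_def flip: sum_divide_distrib)
      show "p i \<le> ((1 / D \<mu>) *\<^sub>R (z + \<mu> *\<^sub>R 1)) $ i" for i
        using z(1)[of i] D0 by (simp add: p_def divide_right_mono)
      show "((1 / D \<mu>) *\<^sub>R (z + \<mu> *\<^sub>R 1)) $ i \<le> 1" for i
        using z(2)[of i] D D0 by (simp add: divide_le_eq_1)
      show "0 \<le> v i" if "i \<in> Iplus" for i
        using y[OF that] l[of i] by (simp add: v_def)
      have "p i * g (a $ i * v i) = persp g (a $ i * y $ i) (lam $ i + \<mu>) / D \<mu>" for i
        by (simp add: p_def v_def persp_def)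
      then show "(\<Sum>i\<in>UNIV. p i * g (a $ i * v i)) \<le> t / D \<mu>"
        using cost[OF \<mu>] D0 by (simp add: divide_right_mono flip: sum_divide_distrib)
    qed
    moreover have "p i * v i = ((1 / D \<mu>) *\<^sub>R y) $ i" for i
      using l[of i] by (simp add: p_def v_def)
    then have "(\<chi> i. p i * v i) = (1 / D \<mu>) *\<^sub>R y"
      by (simp add: vec_eq_iff)
    ultimately show ?thesis
      using closure_subset by (auto simp: P_def)
  qed
  have "((\<lambda>\<mu>. D \<mu>) \<longlongrightarrow> D 0) (at_right 0)"
    unfolding D_def by (intro tendsto_intros)
  then have "(P \<longlongrightarrow> (t / D 0, (1 / D 0) *\<^sub>R y, (1 / D 0) *\<^sub>R (z + 0 *\<^sub>R 1))) (at_right 0)"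
    unfolding P_def by (intro tendsto_intros) (auto simp: D_def)
  then have "(P \<longlongrightarrow> (t, y, z)) (at_right 0)"
    by (simp add: D_def)
  then show ?thesis
  proof (rule Lim_in_closed_set[OF closed_closure, rotated -1])
    show "\<forall>\<^sub>F \<mu> in at_right 0. P \<mu> \<in> closure (convex hull Q1 g a Iplus)"
      unfolding eventually_at_right_field using mem by (intro exI[of _ 1]) auto
  qed simp
qed

text \<open>As \<open>a \<bullet> tau = 0\<close> and \<open>g 0 = 0\<close>, the point \<open>(0, tau / e, 1)\<close> lies in \<open>Q1\<close> for every \<open>e > 0\<close>.
  Mixing it in with weight \<open>e\<close> adds \<open>tau\<close> to the \<open>x\<close> part and, for small \<open>e\<close>, hardly changes
  the rest.\<close>

lemma add_cancelling_direction:
  fixes a tau :: "real ^ 'n"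
  assumes g0: "g 0 = 0" and tau: "a \<bullet> tau = 0" "\<And>i. i \<in> Iplus \<Longrightarrow> 0 \<le> tau $ i"
    and mem: "(t, y, z) \<in> closure (convex hull Q1 g a Iplus)"
  shows "(t, y + tau, z) \<in> closure (convex hull Q1 g a Iplus)" (is "_ \<in> ?H")
proof -
  define P where "P e = (1 - e) *\<^sub>R (t, y, z) + (0, tau, e *\<^sub>R 1)" for e :: real
  have P: "P e \<in> ?H" if "0 < e" "e < 1" for e
  proof -
    have "(0, (1 / e) *\<^sub>R tau, 1) \<in> convex hull Q1 g a Iplus"
      using that tau g0 by (intro relaxed_indicator_in_hull) auto
    then have "(0, (1 / e) *\<^sub>R tau, 1) \<in> ?H"
      using closure_subset by blast
    then have "(1 - e) *\<^sub>R (t, y, z) + e *\<^sub>R (0, (1 / e) *\<^sub>R tau, 1) \<in> ?H"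
      using mem that by (intro convexD[OF convex_closure[OF convex_convex_hull]]) auto
    then show ?thesis using that by (simp add: P_def)
  qed
  have "(P \<longlongrightarrow> (1 - 0) *\<^sub>R (t, y, z) + (0, tau, 0 *\<^sub>R 1)) (at_right 0)"
    unfolding P_def by (intro tendsto_intros)
  then have "(P \<longlongrightarrow> (t, y + tau, z)) (at_right 0)"
    by simp
  then show ?thesis
  proof (rule Lim_in_closed_set[OF closed_closure, rotated -1])
    show "\<forall>\<^sub>F e in at_right 0. P e \<in> ?H"
      unfolding eventually_at_right_field using P by (intro exI[of _ 1]) auto
  qed simp
qed

lemma fst_lifted_subset_closure_hull:
  fixes a :: "real ^ 'n"
  assumes "g 0 = 0"
  shows "fst ` lifted g a Iplus \<subseteq> closure (convex hull Q1 g a Iplus)"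
proof (clarsimp)
  fix t and x z lam tau :: "real ^ 'n"
  assume mem: "((t, x, z), (lam, tau)) \<in> lifted g a Iplus"
  note M = mem[unfolded lifted_def, simplified]
  have "(t, x - tau, z) \<in> closure (convex hull Q1 g a Iplus)"
    using M by (intro perspective_point_in_closure[where g = g and lam = lam, OF assms]) auto
  then have "(t, (x - tau) + tau, z) \<in> closure (convex hull Q1 g a Iplus)"
    using M by (intro add_cancelling_direction[where g = g, OF assms]) auto
  then show "(t, x, z) \<in> closure (convex hull Q1 g a Iplus)" by simp
qed

theorem proposition3:
  fixes g :: "real \<Rightarrow> real" and a :: "real ^ 'n" and Iplus :: "'n set"
    and t :: real and x z :: "real ^ 'n"
  assumes "convex_on UNIV g" and "g 0 = 0" and "\<And>i. a $ i \<noteq> 0"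
  shows "(t, x, z) \<in> closure (convex hull (Q1 g a Iplus)) \<longleftrightarrow>
    (\<exists>lam tau :: real ^ 'n.
       ereal t \<ge> (\<Sum>i\<in>UNIV. perspective g (a $ i * (x $ i - tau $ i)) (lam $ i)) \<and>
       a \<bullet> tau = 0 \<and>
       (\<forall>i\<in>Iplus. 0 \<le> tau $ i \<and> tau $ i \<le> x $ i) \<and>
       (\<forall>i. lam $ i \<le> z $ i \<and> z $ i \<le> 1) \<and>
       (\<forall>i. 0 \<le> lam $ i) \<and>
       (\<Sum>i\<in>UNIV. lam $ i) \<le> 1)"
proof -
  have "convex (fst ` lifted g a Iplus)"
    by (intro convex_linear_image linear_fst convex_lifted assms)
  then have "closure (convex hull Q1 g a Iplus) \<subseteq> fst ` lifted g a Iplus"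
    by (intro closure_minimal hull_minimal Q1_subset_fst_lifted closed_fst_lifted assms)
  then have "closure (convex hull Q1 g a Iplus) = fst ` lifted g a Iplus"
    using fst_lifted_subset_closure_hull[where g = g, OF assms(2)] by blast
  then have "(t, x, z) \<in> closure (convex hull Q1 g a Iplus) \<longleftrightarrow>
      (\<exists>lam tau. ((t, x, z), (lam, tau)) \<in> lifted g a Iplus)"
    by (force simp: image_iff)
  also have "\<dots> \<longleftrightarrow> (\<exists>lam tau :: real ^ 'n.
       ereal t \<ge> (\<Sum>i\<in>UNIV. perspective g (a $ i * (x $ i - tau $ i)) (lam $ i)) \<and>
       a \<bullet> tau = 0 \<and>
       (\<forall>i\<in>Iplus. 0 \<le> tau $ i \<and> tau $ i \<le> x $ i) \<and>
       (\<forall>i. lam $ i \<le> z $ i \<and> z $ i \<le> 1) \<and>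
       (\<forall>i. 0 \<le> lam $ i) \<and>
       (\<Sum>i\<in>UNIV. lam $ i) \<le> 1)"
    by (intro ex_cong1) (auto simp: lifted_def sum_perspective_le_iff[OF assms(1,2) finite])
  finally show ?thesis .
qed

end
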